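(* Let $X_1,\ldots,X_n$ be i.i.d. observations with density $f$ with respect to $\mu$. Assume that the functions $f_1,\ldots,f_M\in L^2(\mu)$ satisfy $\|f_j\|_\infty\le L_0$ for all $j=1,\ldots,M$, and assume that the unknown density $f$ satisfies $\|f\|_\infty\le L$. Let $\pi_1,\ldots,\pi_M>0$ with $\sum_{j=1}^M\pi_j=1$. Let $$\beta=4L+\frac{8L_0}{3},$$ and let $\hat\theta\in\operatorname{argmin}_{\theta\in\Lambda^M}H_n(\theta)$, where $$H_n(\theta)=\left(\|f_\theta\|^2-\frac2n\sum_{i=1}^nf_\theta(X_i)\right)+\frac12\sum_{j=1}^M\theta_j\|f_\theta-f_j\|^2+\frac\beta n\sum_{j=1}^M\theta_j\log\frac1{\pi_j}.$$ Then for any $x>0$, with probability greater than $1-\exp(-x)$, $$R(f_{\hat\theta})\le\min_{j=1,\ldots,M}\left(R(f_j)+\frac\beta n\log\frac1{\pi_j}\right)+\frac{\beta x}{n}.$$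
   Context: $(\mathcal{X},\mu)$ is a measure space, $f$ is an unknown probability density with respect to $\mu$, and $f_1,\ldots,f_M$ are deterministic functions. $\|\cdot\|$ denotes the $L^2(\mu)$ norm. $\Lambda^M=\{\theta\in\mathbf{R}^M:\ \theta_j\ge0\ \forall j,\ \sum_{j=1}^M\theta_j=1\}$, and $f_\theta=\sum_{j=1}^M\theta_jf_j$ for $\theta\in\Lambda^M$. The risk of $g\in L^2(\mu)$ is $R(g)=\|g\|^2-2\int gf\,d\mu$; for the data-dependent function $f_{\hat\theta}$, $R(f_{\hat\theta})$ is the value of $R$ at the realized function. *)

theory Defs
  imports "HOL-Probability.Probability"
begin

definition L2_fun :: "'a measure \<Rightarrow> ('a \<Rightarrow> real) \<Rightarrow> bool" where
  "L2_fun \<mu> g \<longleftrightarrow> g \<in> borel_measurable \<mu> \<and> integrable \<mu> (\<lambda>x. (g x)\<^sup>2)"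

definition L2_norm :: "'a measure \<Rightarrow> ('a \<Rightarrow> real) \<Rightarrow> real" where
  "L2_norm \<mu> g = sqrt (\<integral>x. (g x)\<^sup>2 \<partial>\<mu>)"

(* Extended-real-valued: an essentially unbounded g has norm \<infinity>. *)
definition Linf_norm :: "'a measure \<Rightarrow> ('a \<Rightarrow> real) \<Rightarrow> ereal" where
  "Linf_norm \<mu> g = esssup \<mu> (\<lambda>x. ereal \<bar>g x\<bar>)"

(* Non-negativity is required only \<mu>-almost everywhere, as densities are determined
   only up to \<mu>-null sets. *)
definition probability_density :: "'a measure \<Rightarrow> ('a \<Rightarrow> real) \<Rightarrow> bool" where
  "probability_density \<mu> f \<longleftrightarrow>
     f \<in> borel_measurable \<mu> \<and> (AE x in \<mu>. 0 \<le> f x) \<and> (\<integral>\<^sup>+x. ennreal (f x) \<partial>\<mu>) = 1"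

definition iid_with_density ::
  "'w measure \<Rightarrow> 'a measure \<Rightarrow> ('a \<Rightarrow> real) \<Rightarrow> nat \<Rightarrow> (nat \<Rightarrow> 'w \<Rightarrow> 'a) \<Rightarrow> bool" where
  "iid_with_density P \<mu> f n X \<longleftrightarrow>
     prob_space.indep_vars P (\<lambda>_. \<mu>) X {1..n} \<and>
     (\<forall>i\<in>{1..n}. distributed P \<mu> (X i) (\<lambda>x. ennreal (f x)))"

(* The number M of functions is CARD('m); R^M is the type real ^ 'm. *)
definition prob_simplex :: "(real ^ 'm) set" where
  "prob_simplex = {\<theta>. (\<forall>j. 0 \<le> \<theta> $ j) \<and> (\<Sum>j\<in>UNIV. \<theta> $ j) = 1}"

definition mixture :: "('m \<Rightarrow> 'a \<Rightarrow> real) \<Rightarrow> real ^ 'm \<Rightarrow> 'a \<Rightarrow> real" where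
  "mixture fs \<theta> = (\<lambda>x. \<Sum>j\<in>UNIV. \<theta> $ j * fs j x)"

definition risk :: "'a measure \<Rightarrow> ('a \<Rightarrow> real) \<Rightarrow> ('a \<Rightarrow> real) \<Rightarrow> real" where
  "risk \<mu> f g = (L2_norm \<mu> g)\<^sup>2 - 2 * (\<integral>x. g x * f x \<partial>\<mu>)"

(* The criterion H_n, evaluated at the realised sample x 1, ..., x n; w is the prior. *)
definition Hn ::
  "'a measure \<Rightarrow> ('m \<Rightarrow> 'a \<Rightarrow> real) \<Rightarrow> ('m \<Rightarrow> real) \<Rightarrow> real \<Rightarrow> nat \<Rightarrow> (nat \<Rightarrow> 'a) \<Rightarrow> real ^ 'm \<Rightarrow> real" where
  "Hn \<mu> fs w \<beta> n x \<theta> =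
     ((L2_norm \<mu> (mixture fs \<theta>))\<^sup>2 - 2 / real n * (\<Sum>i=1..n. mixture fs \<theta> (x i)))
     + 1 / 2 * (\<Sum>j\<in>UNIV. \<theta> $ j * (L2_norm \<mu> (\<lambda>y. mixture fs \<theta> y - fs j y))\<^sup>2)
     + \<beta> / real n * (\<Sum>j\<in>UNIV. \<theta> $ j * ln (1 / w j))"

end

theory Submission
  imports Defs
begin

text \<open>On the simplex the criterion equals \<open>\<parallel>f\<^sub>\<theta>\<parallel>\<^sup>2 / 2\<close> plus a linear function of \<open>\<theta>\<close>, so a minimizer
  beats the vertex \<open>k\<close> by at least \<open>\<parallel>f\<^sub>\<theta> - f\<^sub>k\<parallel>\<^sup>2 / 2\<close>. Since
  \<open>\<Sum>\<^sub>j \<theta>\<^sub>j \<parallel>f\<^sub>\<theta> - f\<^sub>j\<parallel>\<^sup>2 + \<parallel>f\<^sub>\<theta> - f\<^sub>k\<parallel>\<^sup>2 = \<Sum>\<^sub>j \<theta>\<^sub>j \<parallel>f\<^sub>j - f\<^sub>k\<parallel>\<^sup>2\<close>, this bounds the excess risk over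
  \<open>f\<^sub>k\<close> by an expression that is linear in \<open>\<theta>\<close>, hence by its largest value at a vertex: only the
  fixed functions \<open>f\<^sub>j - f\<^sub>k\<close> have to be controlled. The term \<open>\<parallel>f\<^sub>j - f\<^sub>k\<parallel>\<^sup>2 / 2\<close> absorbs their
  variance in Bernstein's bound for the exponential moment, the prior weights pay for the union
  over \<open>j\<close>, and Markov's inequality, strict for a positive random variable, concludes.\<close>

section \<open>Square-integrable functions and mixtures\<close>

lemma L2_norm_sq: "(L2_norm \<mu> g)\<^sup>2 = (\<integral>x. (g x)\<^sup>2 \<partial>\<mu>)"
  by (simp add: L2_norm_def)

lemma L2_fun_measurable [measurable_dest]: "L2_fun \<mu> g \<Longrightarrow> g \<in> borel_measurable \<mu>"
  by (simp add: L2_fun_def)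

lemma L2_fun_integrable_mult:
  assumes "L2_fun \<mu> g" "L2_fun \<mu> h"
  shows "integrable \<mu> (\<lambda>x. g x * h x)"
proof (rule Bochner_Integration.integrable_bound)
  show "integrable \<mu> (\<lambda>x. (g x)\<^sup>2 + (h x)\<^sup>2)"
    using assms by (auto simp: L2_fun_def)
  show "(\<lambda>x. g x * h x) \<in> borel_measurable \<mu>"
    using assms by measurable
  have "\<bar>a * b\<bar> \<le> a\<^sup>2 + b\<^sup>2" for a b :: real
    using sum_squares_bound[of "\<bar>a\<bar>" "\<bar>b\<bar>"] mult_nonneg_nonneg[of "\<bar>a\<bar>" "\<bar>b\<bar>"]
    unfolding abs_mult power2_abs by linarith
  then show "AE x in \<mu>. norm (g x * h x) \<le> norm ((g x)\<^sup>2 + (h x)\<^sup>2)"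
    by simp
qed

lemma L2_fun_scale: "L2_fun \<mu> g \<Longrightarrow> L2_fun \<mu> (\<lambda>x. c * g x)"
  by (auto simp: L2_fun_def power_mult_distrib)

lemma L2_fun_add:
  assumes "L2_fun \<mu> g" "L2_fun \<mu> h"
  shows "L2_fun \<mu> (\<lambda>x. g x + h x)"
proof -
  have "integrable \<mu> (\<lambda>x. (g x)\<^sup>2 + (h x)\<^sup>2 + 2 * (g x * h x))"
    using assms L2_fun_integrable_mult[OF assms] by (auto simp: L2_fun_def)
  also have "(\<lambda>x. (g x)\<^sup>2 + (h x)\<^sup>2 + 2 * (g x * h x)) = (\<lambda>x. (g x + h x)\<^sup>2)"
    by (simp add: fun_eq_iff power2_sum)
  finally show ?thesis
    using assms by (auto simp: L2_fun_def)
qed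

lemma L2_fun_diff: "L2_fun \<mu> g \<Longrightarrow> L2_fun \<mu> h \<Longrightarrow> L2_fun \<mu> (\<lambda>x. g x - h x)"
  using L2_fun_add[of \<mu> g "\<lambda>x. - 1 * h x"] L2_fun_scale[of \<mu> h "- 1"] by simp

lemma L2_fun_abs: "L2_fun \<mu> g \<Longrightarrow> L2_fun \<mu> (\<lambda>x. \<bar>g x\<bar>)"
  by (auto simp: L2_fun_def)

lemma L2_fun_zero: "L2_fun \<mu> (\<lambda>x. 0)"
  by (simp add: L2_fun_def)

lemma L2_fun_sum:
  assumes "\<And>j. j \<in> J \<Longrightarrow> L2_fun \<mu> (g j)"
  shows "L2_fun \<mu> (\<lambda>x. \<Sum>j\<in>J. g j x)"
  using assms by (induction J rule: infinite_finite_induct) (auto intro: L2_fun_add L2_fun_zero)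

lemma L2_fun_mixture:
  assumes "\<And>j. L2_fun \<mu> (fs j)"
  shows "L2_fun \<mu> (mixture fs \<theta>)"
  unfolding mixture_def by (intro L2_fun_sum L2_fun_scale assms)

lemma L2_Cauchy_Schwarz:
  assumes g: "L2_fun \<mu> g" and h: "L2_fun \<mu> h"
  shows "(\<integral>x. g x * h x \<partial>\<mu>)\<^sup>2 \<le> (L2_norm \<mu> g)\<^sup>2 * (L2_norm \<mu> h)\<^sup>2"
proof (cases "L2_norm \<mu> h = 0")
  case True
  then have "AE x in \<mu>. (h x)\<^sup>2 = 0"
    using h by (subst (asm) L2_norm_def, subst integral_nonneg_eq_0_iff_AE[symmetric])
      (auto simp: L2_fun_def)
  then have "(\<integral>x. g x * h x \<partial>\<mu>) = (\<integral>x. 0 \<partial>\<mu>)"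
    using g h by (intro integral_cong_AE) (auto simp: L2_fun_def)
  then show ?thesis
    by simp
next
  case False
  define A B C where "A = (\<integral>x. (g x)\<^sup>2 \<partial>\<mu>)" and "B = (\<integral>x. g x * h x \<partial>\<mu>)"
    and "C = (\<integral>x. (h x)\<^sup>2 \<partial>\<mu>)"
  have C: "C > 0"
    using False unfolding C_def L2_norm_sq[symmetric] by simp
  \<comment> \<open>Up to the factor \<open>C\<close>, the integrand is the square of the residual
    of projecting \<open>g\<close> onto \<open>h\<close>; its integral is \<open>C\<close> times the
    Cauchy-Schwarz gap.\<close>
  have "0 \<le> (\<integral>x. (C * g x - B * h x)\<^sup>2 \<partial>\<mu>)"
    by simp
  also have "\<dots> = (\<integral>x. C\<^sup>2 * (g x)\<^sup>2 - 2 * C * B * (g x * h x) + B\<^sup>2 * (h x)\<^sup>2 \<partial>\<mu>)"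
    by (intro Bochner_Integration.integral_cong) (auto simp: power2_eq_square algebra_simps)
  also have "\<dots> = C\<^sup>2 * A - 2 * C * B * B + B\<^sup>2 * C"
    using g h L2_fun_integrable_mult[OF g h] by (simp add: L2_fun_def A_def B_def C_def)
  also have "\<dots> = C * (A * C - B\<^sup>2)"
    by (simp add: power2_eq_square algebra_simps)
  finally have "B\<^sup>2 \<le> A * C"
    using C by (simp add: zero_le_mult_iff)
  then show ?thesis
    by (simp add: L2_norm_sq A_def B_def C_def)
qed

text \<open>This is strong convexity of the squared norm as an exact identity: the subtracted term
  is the gain over the chord, which the criterion inherits with factor 1/2.\<close>

lemma L2_norm_convex_combination:
  assumes g: "L2_fun \<mu> g" and h: "L2_fun \<mu> h"
  shows "(L2_norm \<mu> (\<lambda>x. (1 - t) * g x + t * h x))\<^sup>2 =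
    (1 - t) * (L2_norm \<mu> g)\<^sup>2 + t * (L2_norm \<mu> h)\<^sup>2 - t * (1 - t) * (L2_norm \<mu> (\<lambda>x. g x - h x))\<^sup>2"
proof -
  have "(\<integral>x. ((1 - t) * g x + t * h x)\<^sup>2 \<partial>\<mu>) =
      (\<integral>x. (1 - t) * (g x)\<^sup>2 + t * (h x)\<^sup>2 - t * (1 - t) * (g x - h x)\<^sup>2 \<partial>\<mu>)"
    by (intro Bochner_Integration.integral_cong) (auto simp: power2_eq_square algebra_simps)
  also have "\<dots> = (1 - t) * (\<integral>x. (g x)\<^sup>2 \<partial>\<mu>) + t * (\<integral>x. (h x)\<^sup>2 \<partial>\<mu>)
      - t * (1 - t) * (\<integral>x. (g x - h x)\<^sup>2 \<partial>\<mu>)"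
    using g h L2_fun_diff[OF g h] by (simp add: L2_fun_def)
  finally show ?thesis
    by (simp add: L2_norm_sq)
qed

lemma mixture_axis: "mixture fs (axis k 1) = fs k"
  by (simp add: mixture_def axis_def fun_eq_iff if_distrib[of "\<lambda>z. z * _"] cong: if_cong)

lemma axis_in_prob_simplex: "axis k 1 \<in> prob_simplex"
  by (simp add: prob_simplex_def axis_def)

lemma mixture_convex_combination:
  "mixture fs ((1 - t) *\<^sub>R \<theta> + t *\<^sub>R \<eta>) = (\<lambda>x. (1 - t) * mixture fs \<theta> x + t * mixture fs \<eta> x)"
  by (simp add: mixture_def sum.distrib sum_distrib_left algebra_simps sum_subtractf)

lemma prob_simplex_convex:
  assumes "\<theta> \<in> prob_simplex" "\<eta> \<in> prob_simplex" "0 \<le> t" "t \<le> 1"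
  shows "(1 - t) *\<^sub>R \<theta> + t *\<^sub>R \<eta> \<in> prob_simplex"
  using assms by (auto simp: prob_simplex_def sum.distrib simp flip: sum_distrib_left)

lemma norm_prob_simplex_le_1: "\<theta> \<in> prob_simplex \<Longrightarrow> norm \<theta> \<le> 1"
  using norm_le_l1_cart[of \<theta>] by (simp add: prob_simplex_def)

text \<open>Pointwise, this is the bias-variance decomposition of a variable taking the value
  \<open>fs j x\<close> with probability \<open>\<theta> $ j\<close>, centred at \<open>h x\<close>.
  With \<open>h\<close> zero it simplifies the penalty in \<open>Hn\<close>; with
  \<open>h = fs k\<close> it makes the final bound linear in \<open>\<theta>\<close>.\<close>

lemma mixture_bias_variance:
  fixes fs :: "'m::finite \<Rightarrow> 'a \<Rightarrow> real"
  assumes fs: "\<And>j. L2_fun \<mu> (fs j)" and h: "L2_fun \<mu> h" and \<theta>: "\<theta> \<in> prob_simplex"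
  shows "(\<Sum>j\<in>UNIV. \<theta> $ j * (L2_norm \<mu> (\<lambda>x. fs j x - h x))\<^sup>2) =
    (L2_norm \<mu> (\<lambda>x. mixture fs \<theta> x - h x))\<^sup>2
    + (\<Sum>j\<in>UNIV. \<theta> $ j * (L2_norm \<mu> (\<lambda>x. mixture fs \<theta> x - fs j x))\<^sup>2)"
proof -
  have int: "integrable \<mu> (\<lambda>x. (g x)\<^sup>2)" if "L2_fun \<mu> g" for g
    using that by (simp add: L2_fun_def)
  have pt: "(\<Sum>j\<in>UNIV. \<theta> $ j * (fs j x - h x)\<^sup>2) =
      (mixture fs \<theta> x - h x)\<^sup>2 + (\<Sum>j\<in>UNIV. \<theta> $ j * (mixture fs \<theta> x - fs j x)\<^sup>2)" for x
  proof -
    define m where "m = mixture fs \<theta> x"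
    have 1: "(\<Sum>j\<in>UNIV. \<theta> $ j) = 1" and 2: "(\<Sum>j\<in>UNIV. \<theta> $ j * fs j x) = m"
      using \<theta> by (simp_all add: prob_simplex_def m_def mixture_def)
    \<comment> \<open>Used at \<open>c = h x\<close> and at \<open>c = m\<close>; the difference of
      the two instances is the squared bias.\<close>
    have expand: "(\<Sum>j\<in>UNIV. \<theta> $ j * (fs j x - c)\<^sup>2) =
        (\<Sum>j\<in>UNIV. \<theta> $ j * (fs j x)\<^sup>2) - 2 * c * m + c\<^sup>2" for c
    proof -
      have "(\<Sum>j\<in>UNIV. \<theta> $ j * (fs j x - c)\<^sup>2) =
          (\<Sum>j\<in>UNIV. \<theta> $ j * (fs j x)\<^sup>2 - 2 * c * (\<theta> $ j * fs j x) + c\<^sup>2 * \<theta> $ j)"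
        by (intro sum.cong) (auto simp: power2_eq_square algebra_simps)
      also have "\<dots> = (\<Sum>j\<in>UNIV. \<theta> $ j * (fs j x)\<^sup>2) - 2 * c * m + c\<^sup>2 * 1"
        by (simp only: sum.distrib sum_subtractf 1[symmetric] 2[symmetric] sum_distrib_left)
      finally show ?thesis
        by simp
    qed
    show ?thesis
      unfolding m_def[symmetric] power2_commute[of m "fs _ x"] expand
      by (simp add: power2_eq_square algebra_simps)
  qed
  have "(\<Sum>j\<in>UNIV. \<theta> $ j * (L2_norm \<mu> (\<lambda>x. fs j x - h x))\<^sup>2) =
      (\<integral>x. (\<Sum>j\<in>UNIV. \<theta> $ j * (fs j x - h x)\<^sup>2) \<partial>\<mu>)"
    unfolding L2_norm_sq
    by (subst Bochner_Integration.integral_sum)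
      (auto intro!: integrable_mult_right int L2_fun_diff fs h)
  also have "\<dots> = (\<integral>x. (mixture fs \<theta> x - h x)\<^sup>2 \<partial>\<mu>)
      + (\<integral>x. (\<Sum>j\<in>UNIV. \<theta> $ j * (mixture fs \<theta> x - fs j x)\<^sup>2) \<partial>\<mu>)"
    unfolding pt
    by (subst Bochner_Integration.integral_add)
      (auto intro!: Bochner_Integration.integrable_sum integrable_mult_right int L2_fun_diff
        L2_fun_mixture fs h)
  also have "(\<integral>x. (\<Sum>j\<in>UNIV. \<theta> $ j * (mixture fs \<theta> x - fs j x)\<^sup>2) \<partial>\<mu>) =
      (\<Sum>j\<in>UNIV. \<theta> $ j * (L2_norm \<mu> (\<lambda>x. mixture fs \<theta> x - fs j x))\<^sup>2)"
    unfolding L2_norm_sq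
    by (subst Bochner_Integration.integral_sum)
      (auto intro!: integrable_mult_right int L2_fun_diff L2_fun_mixture fs)
  finally show ?thesis
    by (simp add: L2_norm_sq)
qed

section \<open>Strong convexity of the criterion\<close>

lemma sum_mixture: "(\<Sum>i\<in>I. mixture fs \<theta> (x i)) = (\<Sum>j\<in>UNIV. \<theta> $ j * (\<Sum>i\<in>I. fs j (x i)))"
  unfolding mixture_def by (subst sum.swap) (simp add: sum_distrib_left)

text \<open>Bias-variance around zero turns the penalty into a linear term minus half of the squared
  norm of the mixture, so the quadratic coefficient drops from 1 to 1/2.\<close>

lemma Hn_on_prob_simplex:
  fixes fs :: "'m::finite \<Rightarrow> 'a \<Rightarrow> real"
  assumes fs: "\<And>j. L2_fun \<mu> (fs j)" and \<theta>: "\<theta> \<in> prob_simplex"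
  shows "Hn \<mu> fs w \<beta> n x \<theta> = 1 / 2 * (L2_norm \<mu> (mixture fs \<theta>))\<^sup>2
    + (\<Sum>j\<in>UNIV. \<theta> $ j * (1 / 2 * (L2_norm \<mu> (fs j))\<^sup>2 - 2 / n * (\<Sum>i=1..n. fs j (x i))
        + \<beta> / n * ln (1 / w j)))"
proof -
  have "(\<Sum>j\<in>UNIV. \<theta> $ j * (L2_norm \<mu> (\<lambda>y. mixture fs \<theta> y - fs j y))\<^sup>2) =
      (\<Sum>j\<in>UNIV. \<theta> $ j * (L2_norm \<mu> (fs j))\<^sup>2) - (L2_norm \<mu> (mixture fs \<theta>))\<^sup>2"
    using mixture_bias_variance[of \<mu> fs "\<lambda>x. 0" \<theta>] fs \<theta> L2_fun_zero[of \<mu>] by simp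
  then show ?thesis
    unfolding Hn_def sum_mixture
    by (simp only: right_diff_distrib distrib_left sum.distrib sum_subtractf mult.left_commute[of "_ $ _"]
        sum_distrib_left[symmetric])
qed

lemma Hn_convex_combination:
  fixes fs :: "'m::finite \<Rightarrow> 'a \<Rightarrow> real"
  assumes fs: "\<And>j. L2_fun \<mu> (fs j)" and \<theta>: "\<theta> \<in> prob_simplex" and \<eta>: "\<eta> \<in> prob_simplex"
    and t: "0 \<le> t" "t \<le> 1"
  shows "Hn \<mu> fs w \<beta> n x ((1 - t) *\<^sub>R \<theta> + t *\<^sub>R \<eta>) =
    (1 - t) * Hn \<mu> fs w \<beta> n x \<theta> + t * Hn \<mu> fs w \<beta> n x \<eta>
    - t * (1 - t) / 2 * (L2_norm \<mu> (\<lambda>y. mixture fs \<theta> y - mixture fs \<eta> y))\<^sup>2"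
proof -
  define c where "c j = 1 / 2 * (L2_norm \<mu> (fs j))\<^sup>2 - 2 / n * (\<Sum>i=1..n. fs j (x i))
        + \<beta> / n * ln (1 / w j)" for j
  have H: "Hn \<mu> fs w \<beta> n x \<zeta> = 1 / 2 * (L2_norm \<mu> (mixture fs \<zeta>))\<^sup>2 + (\<Sum>j\<in>UNIV. \<zeta> $ j * c j)"
    if "\<zeta> \<in> prob_simplex" for \<zeta>
    using Hn_on_prob_simplex[of \<mu> fs \<zeta> w \<beta> n x] fs that by (simp add: c_def)
  have lin: "(\<Sum>j\<in>UNIV. ((1 - t) *\<^sub>R \<theta> + t *\<^sub>R \<eta>) $ j * c j) =
      (1 - t) * (\<Sum>j\<in>UNIV. \<theta> $ j * c j) + t * (\<Sum>j\<in>UNIV. \<eta> $ j * c j)"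
    by (simp add: sum_distrib_left sum.distrib[symmetric] algebra_simps del: sum.distrib)
  show ?thesis
    unfolding H[OF \<theta>] H[OF \<eta>] H[OF prob_simplex_convex[OF \<theta> \<eta> t]] lin mixture_convex_combination
      L2_norm_convex_combination[OF L2_fun_mixture[of \<mu> fs, OF fs] L2_fun_mixture[of \<mu> fs, OF fs]]
    by (simp add: field_simps)
qed

text \<open>Moving from the minimizer towards \<open>\<eta>\<close> by a step \<open>t\<close>
  cannot decrease the criterion. Dividing by \<open>t\<close> leaves the strong convexity gain with
  factor \<open>1 - t\<close>, which tends to 1.\<close>

lemma Hn_minimizer_strong:
  fixes fs :: "'m::finite \<Rightarrow> 'a \<Rightarrow> real"
  assumes fs: "\<And>j. L2_fun \<mu> (fs j)" and \<eta>: "\<eta> \<in> prob_simplex"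
    and min: "is_arg_min (Hn \<mu> fs w \<beta> n x) (\<lambda>\<theta>. \<theta> \<in> prob_simplex) \<theta>"
  shows "Hn \<mu> fs w \<beta> n x \<theta> + 1 / 2 * (L2_norm \<mu> (\<lambda>y. mixture fs \<theta> y - mixture fs \<eta> y))\<^sup>2
    \<le> Hn \<mu> fs w \<beta> n x \<eta>"
proof -
  define H where "H = Hn \<mu> fs w \<beta> n x"
  define N where "N = (L2_norm \<mu> (\<lambda>y. mixture fs \<theta> y - mixture fs \<eta> y))\<^sup>2"
  have \<theta>: "\<theta> \<in> prob_simplex" and le: "\<And>\<zeta>. \<zeta> \<in> prob_simplex \<Longrightarrow> H \<theta> \<le> H \<zeta>"
    using min by (auto simp: is_arg_min_linorder H_def)
  have "H \<theta> + (1 - t) / 2 * N \<le> H \<eta>" if t: "0 < t" "t < 1" for t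
  proof -
    have "H \<theta> \<le> (1 - t) * H \<theta> + t * H \<eta> - t * (1 - t) / 2 * N"
      using le[OF prob_simplex_convex[OF \<theta> \<eta>, of t]] t
      by (simp add: H_def N_def Hn_convex_combination[where fs = fs, OF fs \<theta> \<eta>])
    then have "t * (H \<theta> + (1 - t) / 2 * N) \<le> t * H \<eta>"
      by (simp add: algebra_simps)
    then show ?thesis
      using t by simp
  qed
  then have "eventually (\<lambda>t. H \<theta> + (1 - t) / 2 * N \<le> H \<eta>) (at_right 0)"
    by (intro eventually_at_rightI[of 0 1]) auto
  moreover have "((\<lambda>t. H \<theta> + (1 - t) / 2 * N) \<longlongrightarrow> H \<theta> + (1 - 0) / 2 * N) (at_right 0)"
    by (intro tendsto_intros) auto
  ultimately have "H \<theta> + (1 - 0) / 2 * N \<le> H \<eta>"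
    by (intro tendsto_upperbound[where F = "at_right 0"]) auto
  then show ?thesis
    by (simp add: H_def N_def)
qed

text \<open>No randomness enters: this holds for every sample. The penalty contributes
  \<open>V / 2\<close>, strong convexity at the vertex \<open>k\<close> contributes
  \<open>D / 2\<close>, and their sum is linear in \<open>\<theta>\<close> by bias-variance around
  \<open>fs k\<close>.\<close>

lemma oracle_inequality_deterministic:
  fixes fs :: "'m::finite \<Rightarrow> 'a \<Rightarrow> real"
  assumes fs: "\<And>j. L2_fun \<mu> (fs j)" and f: "L2_fun \<mu> f" and n: "n \<ge> 1"
    and min: "is_arg_min (Hn \<mu> fs w \<beta> n x) (\<lambda>\<theta>. \<theta> \<in> prob_simplex) \<theta>"
  shows "risk \<mu> f (mixture fs \<theta>) - risk \<mu> f (fs k) - \<beta> / n * ln (1 / w k) \<le>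
    (\<Sum>j\<in>UNIV. \<theta> $ j *
      (2 / n * (\<Sum>i=1..n. (fs j (x i) - fs k (x i)) - (\<integral>y. (fs j y - fs k y) * f y \<partial>\<mu>))
       - 1 / 2 * (L2_norm \<mu> (\<lambda>y. fs j y - fs k y))\<^sup>2 - \<beta> / n * ln (1 / w j)))"
proof -
  have \<theta>: "\<theta> \<in> prob_simplex"
    using min by (simp add: is_arg_min_linorder)
  then have sum1: "(\<Sum>j\<in>UNIV. \<theta> $ j) = 1"
    by (simp add: prob_simplex_def)
  define b where "b j = (\<integral>y. fs j y * f y \<partial>\<mu>)" for j
  define s where "s j = (\<Sum>i=1..n. fs j (x i))" for j
  define l where "l j = \<beta> / n * ln (1 / w j)" for j
  define V where "V = (\<Sum>j\<in>UNIV. \<theta> $ j * (L2_norm \<mu> (\<lambda>y. mixture fs \<theta> y - fs j y))\<^sup>2)"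
  define D where "D = (L2_norm \<mu> (\<lambda>y. mixture fs \<theta> y - fs k y))\<^sup>2"
  define N where "N j = (L2_norm \<mu> (\<lambda>y. fs j y - fs k y))\<^sup>2" for j
  have VD: "(\<Sum>j\<in>UNIV. \<theta> $ j * N j) = D + V"
    unfolding N_def D_def V_def by (rule mixture_bias_variance[where fs = fs, OF fs fs \<theta>])
  have int: "integrable \<mu> (\<lambda>y. fs j y * f y)" for j
    using L2_fun_integrable_mult[OF fs f] .
  have fm: "(\<integral>y. mixture fs \<theta> y * f y \<partial>\<mu>) = (\<Sum>j\<in>UNIV. \<theta> $ j * b j)"
    unfolding mixture_def b_def sum_distrib_right mult.assoc
    by (subst Bochner_Integration.integral_sum) (auto intro: int integrable_mult_right)
  \<comment> \<open>At a vertex the quadratic and the linear part each carry half of the squared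
    norm, and the halves recombine.\<close>
  have Hk: "Hn \<mu> fs w \<beta> n x (axis k 1) = (L2_norm \<mu> (fs k))\<^sup>2 - 2 / n * s k + l k"
    unfolding Hn_on_prob_simplex[where fs = fs, OF fs axis_in_prob_simplex] mixture_axis
    by (simp add: s_def l_def axis_def[of k] sum.delta if_distrib[of "\<lambda>z. z * _"] cong: if_cong)
  have H\<theta>: "Hn \<mu> fs w \<beta> n x \<theta> = (L2_norm \<mu> (mixture fs \<theta>))\<^sup>2
      - 2 / n * (\<Sum>j\<in>UNIV. \<theta> $ j * s j) + 1 / 2 * V + (\<Sum>j\<in>UNIV. \<theta> $ j * l j)"
    unfolding Hn_def sum_mixture s_def V_def l_def
    by (simp add: sum_distrib_left algebra_simps)
  have le: "Hn \<mu> fs w \<beta> n x \<theta> + 1 / 2 * D \<le> Hn \<mu> fs w \<beta> n x (axis k 1)"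
    using Hn_minimizer_strong[where fs = fs, OF fs axis_in_prob_simplex min, of k]
    by (simp add: mixture_axis D_def)
  \<comment> \<open>The integral stands inside the sum over \<open>i\<close>, so it is counted
    \<open>n\<close> times and leaves the factor 2.\<close>
  have dev: "2 / n * (\<Sum>i=1..n. (fs j (x i) - fs k (x i)) - (\<integral>y. (fs j y - fs k y) * f y \<partial>\<mu>)) =
      2 / n * (s j - s k) - 2 * (b j - b k)" for j
  proof -
    have "(\<integral>y. (fs j y - fs k y) * f y \<partial>\<mu>) = b j - b k"
      using int by (simp add: b_def left_diff_distrib)
    then show ?thesis
      using n by (simp add: s_def sum_subtractf right_diff_distrib)
  qed
  have "risk \<mu> f (mixture fs \<theta>) - risk \<mu> f (fs k) - l k \<le>
      2 / n * ((\<Sum>j\<in>UNIV. \<theta> $ j * s j) - s k) - 2 * ((\<Sum>j\<in>UNIV. \<theta> $ j * b j) - b k)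
      - 1 / 2 * (D + V) - (\<Sum>j\<in>UNIV. \<theta> $ j * l j)"
    using le unfolding Hk H\<theta> risk_def fm b_def[symmetric] by (simp add: algebra_simps add_divide_distrib)
  also have "\<dots> = (\<Sum>j\<in>UNIV. \<theta> $ j * (2 / n * (s j - s k) - 2 * (b j - b k) - 1 / 2 * N j - l j))"
  proof -
    have "(\<Sum>j\<in>UNIV. \<theta> $ j * (2 / n * (s j - s k) - 2 * (b j - b k) - 1 / 2 * N j - l j)) =
        (\<Sum>j\<in>UNIV. 2 / n * (\<theta> $ j * s j) - (2 / n * s k) * \<theta> $ j - 2 * (\<theta> $ j * b j)
          + (2 * b k) * \<theta> $ j - 1 / 2 * (\<theta> $ j * N j) - \<theta> $ j * l j)"
      by (intro sum.cong) (auto simp: algebra_simps diff_divide_distrib)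
    also have "\<dots> = 2 / n * (\<Sum>j\<in>UNIV. \<theta> $ j * s j) - (2 / n * s k) * 1
        - 2 * (\<Sum>j\<in>UNIV. \<theta> $ j * b j) + (2 * b k) * 1 - 1 / 2 * (D + V) - (\<Sum>j\<in>UNIV. \<theta> $ j * l j)"
      by (simp only: sum.distrib sum_subtractf sum1[symmetric] VD[symmetric] sum_distrib_left)
    finally show ?thesis
      by (simp add: algebra_simps)
  qed
  finally show ?thesis
    unfolding dev N_def l_def .
qed

section \<open>Measurability of the risk of the minimizer\<close>

text \<open>The minimizer itself need not be measurable in the sample. By strong convexity its mixture
  is nevertheless determined up to null sets, and depends continuously on the sums of the \<open>fs j\<close> over
  the sample.\<close>

lemma minimizer_stability:
  fixes fs :: "'m::finite \<Rightarrow> 'a \<Rightarrow> real"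
  assumes fs: "\<And>j. L2_fun \<mu> (fs j)"
    and min1: "is_arg_min (Hn \<mu> fs w \<beta> n x) (\<lambda>\<theta>. \<theta> \<in> prob_simplex) \<theta>"
    and min2: "is_arg_min (Hn \<mu> fs w \<beta> n x') (\<lambda>\<theta>. \<theta> \<in> prob_simplex) \<theta>'"
  shows "(L2_norm \<mu> (\<lambda>y. mixture fs \<theta> y - mixture fs \<theta>' y))\<^sup>2 \<le>
    4 / n * dist (\<chi> j. \<Sum>i=1..n. fs j (x i)) (\<chi> j. \<Sum>i=1..n. fs j (x' i))"
proof -
  define N where "N = (L2_norm \<mu> (\<lambda>y. mixture fs \<theta> y - mixture fs \<theta>' y))\<^sup>2"
  define v where "v x = (\<chi> j. \<Sum>i=1..n. fs j (x i))" for x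
  have \<theta>: "\<theta> \<in> prob_simplex" and \<theta>': "\<theta>' \<in> prob_simplex"
    using min1 min2 by (simp_all add: is_arg_min_linorder)
  have N': "(L2_norm \<mu> (\<lambda>y. mixture fs \<theta>' y - mixture fs \<theta> y))\<^sup>2 = N"
    by (simp add: N_def L2_norm_sq power2_commute)
  \<comment> \<open>The sample enters the criterion only through a term linear in
    \<open>\<zeta>\<close>.\<close>
  have Hd: "Hn \<mu> fs w \<beta> n x \<zeta> - Hn \<mu> fs w \<beta> n x' \<zeta> = - (2 / n * (\<zeta> \<bullet> (v x - v x')))" for \<zeta>
    unfolding Hn_def sum_mixture v_def
    by (simp add: inner_vec_def sum_subtractf algebra_simps)
  \<comment> \<open>Each minimizer is tested against the other; the two gains of
    \<open>N / 2\<close> add up.\<close>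
  have "N \<le> (Hn \<mu> fs w \<beta> n x \<theta>' - Hn \<mu> fs w \<beta> n x' \<theta>') - (Hn \<mu> fs w \<beta> n x \<theta> - Hn \<mu> fs w \<beta> n x' \<theta>)"
    using Hn_minimizer_strong[where fs = fs, OF fs \<theta>' min1] Hn_minimizer_strong[where fs = fs, OF fs \<theta> min2]
    unfolding N' N_def[symmetric] by simp
  also have "\<dots> = 2 / n * ((\<theta> - \<theta>') \<bullet> (v x - v x'))"
    unfolding Hd by (simp add: algebra_simps)
  also have "\<dots> \<le> 2 / n * (norm (\<theta> - \<theta>') * norm (v x - v x'))"
    by (intro mult_left_mono norm_cauchy_schwarz) auto
  \<comment> \<open>The simplex lies in the unit ball, so its diameter is at most 2.\<close>
  also have "\<dots> \<le> 2 / n * (2 * norm (v x - v x'))"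
    using norm_triangle_ineq4[of \<theta> \<theta>'] norm_prob_simplex_le_1[OF \<theta>] norm_prob_simplex_le_1[OF \<theta>']
    by (intro mult_left_mono mult_right_mono) auto
  finally show ?thesis
    by (simp add: N_def v_def dist_norm)
qed

text \<open>The difference of the risks is the integral of \<open>(g + h - 2 * f) * (g - h)\<close>
  for the two mixtures \<open>g\<close> and \<open>h\<close>. Cauchy-Schwarz applies, and the first
  factor has an envelope that does not depend on the weights.\<close>

lemma risk_diff_sq_le:
  fixes fs :: "'m::finite \<Rightarrow> 'a \<Rightarrow> real"
  assumes fs: "\<And>j. L2_fun \<mu> (fs j)" and f: "L2_fun \<mu> f"
    and \<theta>: "\<theta> \<in> prob_simplex" and \<theta>': "\<theta>' \<in> prob_simplex"
  shows "(risk \<mu> f (mixture fs \<theta>) - risk \<mu> f (mixture fs \<theta>'))\<^sup>2 \<le>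
    (L2_norm \<mu> (\<lambda>y. 2 * ((\<Sum>j\<in>UNIV. \<bar>fs j y\<bar>) + \<bar>f y\<bar>)))\<^sup>2
    * (L2_norm \<mu> (\<lambda>y. mixture fs \<theta> y - mixture fs \<theta>' y))\<^sup>2"
proof -
  let ?g = "mixture fs \<theta>" and ?h = "mixture fs \<theta>'"
  let ?K = "\<lambda>y. 2 * ((\<Sum>j\<in>UNIV. \<bar>fs j y\<bar>) + \<bar>f y\<bar>)"
  note L2 = L2_fun_mixture[where fs = fs, OF fs, of \<theta>] L2_fun_mixture[where fs = fs, OF fs, of \<theta>']
  have K: "L2_fun \<mu> ?K"
    by (intro L2_fun_scale L2_fun_add L2_fun_sum L2_fun_abs fs f)
  have S: "L2_fun \<mu> (\<lambda>y. ?g y + ?h y - 2 * f y)"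
    by (intro L2_fun_diff L2_fun_add L2_fun_scale L2 f)
  have bound: "\<bar>mixture fs \<zeta> y\<bar> \<le> (\<Sum>j\<in>UNIV. \<bar>fs j y\<bar>)" if "\<zeta> \<in> prob_simplex" for \<zeta> y
  proof -
    have "\<zeta> $ j \<le> 1" for j
      using component_le_norm_cart[of \<zeta> j] norm_prob_simplex_le_1[OF that] by linarith
    then have "\<bar>\<zeta> $ j * fs j y\<bar> \<le> \<bar>fs j y\<bar>" for j
      using that by (auto simp: prob_simplex_def abs_mult intro!: mult_left_le_one_le)
    then show ?thesis
      unfolding mixture_def by (intro order_trans[OF sum_abs] sum_mono)
  qed
  have "\<bar>?g y + ?h y - 2 * f y\<bar> \<le> ?K y" for y
    using bound[OF \<theta>, of y] bound[OF \<theta>', of y] abs_ge_self[of "f y"] abs_ge_minus_self[of "f y"]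
    unfolding abs_le_iff distrib_left by linarith
  then have "\<bar>?g y + ?h y - 2 * f y\<bar> \<le> \<bar>?K y\<bar>" for y
    by (rule order_trans) simp
  then have sq: "(?g y + ?h y - 2 * f y)\<^sup>2 \<le> (?K y)\<^sup>2" for y
    unfolding abs_le_square_iff .
  have SK: "(L2_norm \<mu> (\<lambda>y. ?g y + ?h y - 2 * f y))\<^sup>2 \<le> (L2_norm \<mu> ?K)\<^sup>2"
    unfolding L2_norm_sq using K S
    by (intro integral_mono sq) (simp_all only: L2_fun_def)
  have "risk \<mu> f ?g - risk \<mu> f ?h = (\<integral>y. (?g y)\<^sup>2 - (?h y)\<^sup>2 - 2 * (?g y * f y) + 2 * (?h y * f y) \<partial>\<mu>)"
    using L2 L2_fun_integrable_mult[OF L2(1) f] L2_fun_integrable_mult[OF L2(2) f]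
    by (simp add: risk_def L2_norm_sq L2_fun_def)
  also have "\<dots> = (\<integral>y. (?g y + ?h y - 2 * f y) * (?g y - ?h y) \<partial>\<mu>)"
    by (intro Bochner_Integration.integral_cong) (auto simp: power2_eq_square algebra_simps)
  finally have "(risk \<mu> f ?g - risk \<mu> f ?h)\<^sup>2 \<le>
      (L2_norm \<mu> (\<lambda>y. ?g y + ?h y - 2 * f y))\<^sup>2 * (L2_norm \<mu> (\<lambda>y. ?g y - ?h y))\<^sup>2"
    using L2_Cauchy_Schwarz[OF S L2_fun_diff[OF L2]] by simp
  also have "\<dots> \<le> (L2_norm \<mu> ?K)\<^sup>2 * (L2_norm \<mu> (\<lambda>y. ?g y - ?h y))\<^sup>2"
    by (intro mult_right_mono SK) simp
  finally show ?thesis .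
qed

text \<open>The bound forces \<open>h\<close> to agree wherever \<open>v\<close> does, so
  \<open>h\<close> factors through \<open>v\<close>; the factor \<open>\<phi>\<close> is Hoelder
  continuous of order 1/2 on the image of \<open>v\<close>.\<close>

lemma borel_measurable_of_sq_dist_le:
  fixes h :: "'w \<Rightarrow> real" and v :: "'w \<Rightarrow> 'b::metric_space"
  assumes v: "v \<in> borel_measurable P"
    and le: "\<And>\<omega> \<omega>'. \<omega> \<in> space P \<Longrightarrow> \<omega>' \<in> space P \<Longrightarrow> (h \<omega> - h \<omega>')\<^sup>2 \<le> C * dist (v \<omega>) (v \<omega>')"
  shows "h \<in> borel_measurable P"
proof -
  define V where "V = v ` space P"
  define \<phi> where "\<phi> u = h (SOME \<omega>. \<omega> \<in> space P \<and> v \<omega> = u)" for u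
  have pre: "\<exists>\<omega>. \<omega> \<in> space P \<and> v \<omega> = u \<and> \<phi> u = h \<omega>" if "u \<in> V" for u
    using that someI_ex[of "\<lambda>\<omega>. \<omega> \<in> space P \<and> v \<omega> = u"] by (auto simp: V_def \<phi>_def)
  have le\<phi>: "(\<phi> u - \<phi> u')\<^sup>2 \<le> C * dist u u'" if "u \<in> V" "u' \<in> V" for u u'
    using pre[OF that(1)] pre[OF that(2)] le by metis
  have "continuous_on V \<phi>"
    unfolding continuous_on_def
  proof
    fix u assume u: "u \<in> V"
    have "((\<lambda>u'. sqrt (C * dist u' u)) \<longlongrightarrow> sqrt (C * dist u u)) (at u within V)"
      by (intro tendsto_intros)
    then have "((\<lambda>u'. sqrt (C * dist u' u)) \<longlongrightarrow> 0) (at u within V)"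
      by simp
    moreover have "eventually (\<lambda>u'. norm (\<phi> u' - \<phi> u) \<le> sqrt (C * dist u' u)) (at u within V)"
      unfolding eventually_at_topological using le\<phi> u
      by (auto intro!: exI[of _ UNIV] real_le_rsqrt)
    ultimately have "((\<lambda>u'. \<phi> u' - \<phi> u) \<longlongrightarrow> 0) (at u within V)"
      by (rule Lim_null_comparison[rotated])
    then show "(\<phi> \<longlongrightarrow> \<phi> u) (at u within V)"
      by (simp add: Lim_null[symmetric])
  qed
  \<comment> \<open>The image \<open>V\<close> may fail to be a Borel set, hence the trace
    sigma-algebra.\<close>
  then have "\<phi> \<in> borel_measurable (restrict_space borel V)"
    by (rule borel_measurable_continuous_on_restrict)
  moreover have "v \<in> measurable P (restrict_space borel V)"
    using v by (intro measurable_restrict_space2) (auto simp: V_def)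
  ultimately have "(\<lambda>\<omega>. \<phi> (v \<omega>)) \<in> borel_measurable P"
    by (rule measurable_compose[rotated])
  moreover have "\<phi> (v \<omega>) = h \<omega>" if \<omega>: "\<omega> \<in> space P" for \<omega>
  proof -
    obtain \<omega>' where "\<omega>' \<in> space P" "v \<omega>' = v \<omega>" "\<phi> (v \<omega>) = h \<omega>'"
      using pre[of "v \<omega>"] \<omega> by (auto simp: V_def)
    then show ?thesis
      using le[of \<omega>' \<omega>] \<omega> by simp
  qed
  ultimately show ?thesis
    by (subst measurable_cong[symmetric]) auto
qed

section \<open>Bernstein's exponential moment bound\<close>

text \<open>After the factor 2, the factorial has \<open>k\<close> further factors, all at least 3.
  This is the source of the 3 in Bernstein's bound.\<close>

lemma two_mult_3_power_le_fact: "2 * 3 ^ k \<le> (fact (k + 2) :: real)"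
proof (induction k)
  case (Suc k)
  have "2 * 3 ^ Suc k = 3 * (2 * 3 ^ k :: real)"
    by simp
  also have "\<dots> \<le> (real k + 3) * fact (k + 2)"
    using Suc by (intro mult_mono) auto
  also have "\<dots> = fact (Suc k + 2)"
    by (simp add: algebra_simps)
  finally show ?case .
qed (simp add: fact_2)

text \<open>From the second order on, the exponential series is dominated by a geometric series of
  ratio \<open>B / 3\<close>.\<close>

lemma exp_le_quadratic:
  fixes u B :: real
  assumes u: "\<bar>u\<bar> \<le> B" and B: "B < 3"
  shows "exp u \<le> 1 + u + u\<^sup>2 / (2 * (1 - B / 3))"
proof -
  have B0: "0 \<le> B"
    using u by linarith
  have coeff: "inverse (fact (k + 2)) *\<^sub>R u ^ (k + 2) \<le> u\<^sup>2 / 2 * (B / 3) ^ k" for k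
  proof -
    have "inverse (fact (k + 2)) *\<^sub>R u ^ (k + 2) \<le> u\<^sup>2 * B ^ k / fact (k + 2)"
    proof -
      have "u ^ k \<le> B ^ k"
        using power_mono[OF u, of k] abs_ge_self[of "u ^ k"] by (simp add: power_abs)
      then have "u\<^sup>2 * u ^ k \<le> u\<^sup>2 * B ^ k"
        by (intro mult_left_mono) auto
      then show ?thesis
        by (simp add: field_simps power_add power2_eq_square del: fact_Suc)
    qed
    also have "\<dots> \<le> u\<^sup>2 * B ^ k / (2 * 3 ^ k)"
      using two_mult_3_power_le_fact[of k] B0 by (intro divide_left_mono) (auto simp del: fact_Suc)
    finally show ?thesis
      by (simp add: power_divide)
  qed
  have geo: "summable (\<lambda>k. (B / 3) ^ k)" "(\<Sum>k. (B / 3) ^ k) = 1 / (1 - B / 3)"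
    using B B0 by (auto intro: summable_geometric suminf_geometric)
  have "exp u = 1 + u + (\<Sum>k. inverse (fact (k + 2)) *\<^sub>R u ^ (k + 2))"
    by (rule exp_first_two_terms)
  also have "(\<Sum>k. inverse (fact (k + 2)) *\<^sub>R u ^ (k + 2)) \<le> (\<Sum>k. u\<^sup>2 / 2 * (B / 3) ^ k)"
    using summable_exp_generic[of u] geo(1)
    by (intro suminf_le coeff summable_mult)
      (simp_all only: summable_iff_shift[of "\<lambda>k. inverse (fact k) *\<^sub>R u ^ k" 2] divide_inverse_commute)
  also have "\<dots> = u\<^sup>2 / 2 * (1 / (1 - B / 3))"
    unfolding geo(2)[symmetric] by (rule suminf_mult[OF geo(1)])
  finally show ?thesis
    by simp
qed

text \<open>Take expectations in the quadratic bound: the linear term vanishes because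
  \<open>Z\<close> is centred, and \<open>1 + y \<le> exp y\<close> puts the second moment into the
  exponent.\<close>

lemma (in prob_space) Bernstein_mgf:
  fixes Z :: "'a \<Rightarrow> real"
  assumes Z [measurable]: "random_variable borel Z" and bound: "AE \<omega> in M. \<bar>Z \<omega>\<bar> \<le> b"
    and mean: "expectation Z = 0" and t: "0 \<le> t" "t * b < 3"
  shows "integrable M (\<lambda>\<omega>. exp (t * Z \<omega>))"
    and "expectation (\<lambda>\<omega>. exp (t * Z \<omega>)) \<le>
      exp (t\<^sup>2 * expectation (\<lambda>\<omega>. (Z \<omega>)\<^sup>2) / (2 * (1 - t * b / 3)))"
proof -
  have tb: "AE \<omega> in M. \<bar>t * Z \<omega>\<bar> \<le> t * b"
    using bound by eventually_elim (use t in \<open>auto simp: abs_mult intro!: mult_left_mono\<close>)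
  have intZ: "integrable M Z"
    using bound by (intro integrable_const_bound[of _ b]) auto
  have "AE \<omega> in M. norm ((Z \<omega>)\<^sup>2) \<le> b\<^sup>2"
    using bound by eventually_elim (simp add: abs_le_square_iff[symmetric])
  then have intZ2: "integrable M (\<lambda>\<omega>. (Z \<omega>)\<^sup>2)"
    by (intro integrable_const_bound) auto
  have "AE \<omega> in M. norm (exp (t * Z \<omega>)) \<le> exp (t * b)"
    using tb by eventually_elim simp
  then show int: "integrable M (\<lambda>\<omega>. exp (t * Z \<omega>))"
    by (intro integrable_const_bound) auto
  define c where "c = t\<^sup>2 / (2 * (1 - t * b / 3))"
  have "expectation (\<lambda>\<omega>. exp (t * Z \<omega>)) \<le> expectation (\<lambda>\<omega>. 1 + t * Z \<omega> + c * (Z \<omega>)\<^sup>2)"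
  proof (rule integral_mono_AE[OF int])
    show "AE \<omega> in M. exp (t * Z \<omega>) \<le> 1 + t * Z \<omega> + c * (Z \<omega>)\<^sup>2"
      using tb
    proof eventually_elim
      case (elim \<omega>)
      from exp_le_quadratic[OF elim t(2)] show ?case
        by (simp add: c_def power_mult_distrib)
    qed
  qed (use intZ intZ2 in auto)
  also have "\<dots> = 1 + c * expectation (\<lambda>\<omega>. (Z \<omega>)\<^sup>2)"
    using intZ intZ2 mean by (simp add: prob_space)
  also have "\<dots> \<le> exp (c * expectation (\<lambda>\<omega>. (Z \<omega>)\<^sup>2))"
    by (rule exp_ge_add_one_self)
  finally show "expectation (\<lambda>\<omega>. exp (t * Z \<omega>)) \<le>
      exp (t\<^sup>2 * expectation (\<lambda>\<omega>. (Z \<omega>)\<^sup>2) / (2 * (1 - t * b / 3)))"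
    by (simp add: c_def)
qed

text \<open>Strictness comes from \<open>Y\<close> exceeding \<open>c\<close> times the indicator
  everywhere: on the event by definition, off it by positivity. It yields the strict probability
  bound of the theorem.\<close>

lemma (in prob_space) prob_gt_less:
  fixes Y :: "'a \<Rightarrow> real"
  assumes int: "integrable M Y" and pos: "\<And>\<omega>. \<omega> \<in> space M \<Longrightarrow> 0 < Y \<omega>" and c: "0 < c"
  shows "prob {\<omega> \<in> space M. c < Y \<omega>} < expectation Y / c"
proof -
  define A where "A = {\<omega> \<in> space M. c < Y \<omega>}"
  have [measurable]: "Y \<in> borel_measurable M"
    using int by simp
  have A: "A \<in> events"
    unfolding A_def by measurable
  have "expectation (\<lambda>\<omega>. c * indicator A \<omega>) < expectation Y"
  proof (rule integral_less_AE_space)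
    show "AE \<omega> in M. c * indicator A \<omega> < Y \<omega>"
      using pos by (intro AE_I2) (auto simp: A_def indicator_def)
    show "integrable M (\<lambda>\<omega>. c * indicator A \<omega>)"
      using A by (intro integrable_mult_right integrable_real_indicator) (auto simp: emeasure_eq_measure)
  qed (use int in \<open>auto simp: emeasure_space_1\<close>)
  then show ?thesis
    using A c by (simp add: A_def field_simps)
qed

section \<open>Observations with a bounded density\<close>

text \<open>Passing through the push-forward measure accommodates a density that is nonnegative only
  almost everywhere.\<close>

lemma distributed_integral_AE_nonneg:
  fixes g :: "_ \<Rightarrow> real"
  assumes D: "distributed M N X (\<lambda>x. ennreal (f x))" and f: "f \<in> borel_measurable N"
    and pos: "AE x in N. 0 \<le> f x" and g: "g \<in> borel_measurable N"
  shows "(\<integral>\<omega>. g (X \<omega>) \<partial>M) = (\<integral>x. g x * f x \<partial>N)"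
proof -
  have "(\<integral>\<omega>. g (X \<omega>) \<partial>M) = (\<integral>x. g x \<partial>distr M N X)"
    using g distributed_measurable[OF D] by (subst integral_distr) auto
  also have "\<dots> = (\<integral>x. g x \<partial>density N (\<lambda>x. ennreal (f x)))"
    by (simp add: distributed_distr_eq_density[OF D])
  also have "\<dots> = (\<integral>x. f x *\<^sub>R g x \<partial>N)"
    by (rule integral_density[OF g f pos])
  finally show ?thesis
    by (simp add: mult.commute)
qed

lemma distributed_AE:
  assumes D: "distributed M N X (\<lambda>x. ennreal (f x))" and ae: "AE x in N. Q x"
  shows "AE \<omega> in M. Q (X \<omega>)"
proof -
  have "AE x in density N (\<lambda>x. ennreal (f x)). Q x"
    using ae distributed_borel_measurable[OF D] by (subst AE_density) auto
  then have "AE x in distr M N X. Q x"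
    unfolding distributed_distr_eq_density[OF D] .
  then show ?thesis
    using distributed_measurable[OF D] by (rule AE_distrD[rotated])
qed

lemma Linf_norm_AE: "Linf_norm \<mu> g \<le> ereal c \<Longrightarrow> AE x in \<mu>. \<bar>g x\<bar> \<le> c"
  using esssup_AE[where M = \<mu> and f = "\<lambda>x. ereal \<bar>g x\<bar>"] unfolding Linf_norm_def
  by (auto elim!: eventually_mono dest: order_trans)

lemma probability_density_integral:
  assumes "probability_density \<mu> f"
  shows "integrable \<mu> f" "(\<integral>x. f x \<partial>\<mu>) = 1"
  using assms by (auto simp: probability_density_def integral_eq_nn_integral intro!: integrableI_nonneg)

text \<open>The square of \<open>f\<close> is dominated by \<open>L * f\<close>, which is
  integrable.\<close>

lemma bounded_density_L2:
  assumes f: "probability_density \<mu> f" and L: "AE x in \<mu>. \<bar>f x\<bar> \<le> L"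
  shows "L2_fun \<mu> f"
proof -
  have [measurable]: "f \<in> borel_measurable \<mu>"
    using f by (simp add: probability_density_def)
  have "integrable \<mu> (\<lambda>x. (f x)\<^sup>2)"
  proof (rule Bochner_Integration.integrable_bound)
    show "integrable \<mu> (\<lambda>x. L * f x)"
      using probability_density_integral(1)[OF f] by simp
    show "AE x in \<mu>. norm ((f x)\<^sup>2) \<le> norm (L * f x)"
      using L
    proof eventually_elim
      case (elim x)
      then have "\<bar>f x\<bar> * \<bar>f x\<bar> \<le> \<bar>L\<bar> * \<bar>f x\<bar>"
        by (intro mult_right_mono) auto
      then show ?case
        by (simp add: power2_eq_square abs_mult)
    qed
  qed measurable
  then show ?thesis
    by (simp add: L2_fun_def)
qed

lemma bounded_density_pos:
  assumes f: "probability_density \<mu> f" and L: "AE x in \<mu>. \<bar>f x\<bar> \<le> L"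
  shows "0 < L"
proof (rule ccontr)
  assume "\<not> 0 < L"
  then have "AE x in \<mu>. f x = 0"
    using L by (auto elim!: eventually_mono)
  then have "(\<integral>x. f x \<partial>\<mu>) = 0"
    by (rule integral_eq_zero_AE)
  then show False
    using probability_density_integral(2)[OF f] by simp
qed

text \<open>\<open>g (X i)\<close> minus its mean is bounded by \<open>4 * L\<^sub>0\<close> and has variance at most \<open>L * \<parallel>g\<parallel>\<^sup>2\<close>; the
  choice of \<open>\<beta>\<close> makes the exponent of Bernstein's bound at \<open>t = 2 / \<beta>\<close> equal to
  \<open>\<parallel>g\<parallel>\<^sup>2 / (2 * \<beta>)\<close>.\<close>

lemma (in prob_space) exp_empirical_deviation_le_1:
  fixes g :: "'b \<Rightarrow> real"
  assumes f: "probability_density \<mu> f" and L: "AE x in \<mu>. \<bar>f x\<bar> \<le> L"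
    and iid: "iid_with_density M \<mu> f n X"
    and g: "L2_fun \<mu> g" and gb: "AE x in \<mu>. \<bar>g x\<bar> \<le> 2 * L\<^sub>0" and L0: "0 \<le> L\<^sub>0"
    and \<beta>: "\<beta> = 4 * L + 8 * L\<^sub>0 / 3"
  defines "Y \<equiv> \<lambda>\<omega>. exp (\<Sum>i=1..n. 2 / \<beta> * (g (X i \<omega>) - (\<integral>y. g y * f y \<partial>\<mu>))
                            - 1 / (2 * \<beta>) * (L2_norm \<mu> g)\<^sup>2)"
  shows "integrable M Y" "expectation Y \<le> 1"
proof -
  define m where "m = (\<integral>y. g y * f y \<partial>\<mu>)"
  define N where "N = (L2_norm \<mu> g)\<^sup>2"
  \<comment> \<open>The factor of a single observation: the variance compensation is spread evenly
    over the sample, so \<open>Y\<close> is a product of independent terms.\<close>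
  define h where "h y = exp (2 / \<beta> * (g y - m) - 1 / (2 * \<beta>) * N)" for y
  have Lpos: "0 < L"
    by (rule bounded_density_pos[OF f L])
  then have \<beta>pos: "0 < \<beta>"
    using L0 \<beta> by simp
  have [measurable]: "f \<in> borel_measurable \<mu>" "g \<in> borel_measurable \<mu>"
    and fpos: "AE x in \<mu>. 0 \<le> f x"
    using f g by (auto simp: probability_density_def L2_fun_def)
  have hm: "h \<in> borel_measurable \<mu>"
    unfolding h_def by measurable
  have ind: "indep_vars (\<lambda>_. \<mu>) X {1..n}"
    and D: "\<And>i. i \<in> {1..n} \<Longrightarrow> distributed M \<mu> (X i) (\<lambda>x. ennreal (f x))"
    using iid by (auto simp: iid_with_density_def)
  have factor: "integrable M (\<lambda>\<omega>. h (X i \<omega>)) \<and> expectation (\<lambda>\<omega>. h (X i \<omega>)) \<le> 1"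
    if i: "i \<in> {1..n}" for i
  proof -
    note Di = D[OF i]
    have Xm [measurable]: "X i \<in> measurable M \<mu>"
      using distributed_measurable[OF Di] .
    define Z where "Z \<omega> = g (X i \<omega>) - m" for \<omega>
    have Zm [measurable]: "Z \<in> borel_measurable M"
      unfolding Z_def by measurable
    have gX: "AE \<omega> in M. \<bar>g (X i \<omega>)\<bar> \<le> 2 * L\<^sub>0"
      by (rule distributed_AE[OF Di gb])
    then have intg: "integrable M (\<lambda>\<omega>. g (X i \<omega>))"
      by (intro integrable_const_bound) auto
    have "AE \<omega> in M. norm ((g (X i \<omega>))\<^sup>2) \<le> (2 * L\<^sub>0)\<^sup>2"
      using gX by eventually_elim (use L0 abs_le_square_iff[of _ "2 * L\<^sub>0"] in simp)
    then have intg2: "integrable M (\<lambda>\<omega>. (g (X i \<omega>))\<^sup>2)"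
      by (intro integrable_const_bound) auto
    have Em: "expectation (\<lambda>\<omega>. g (X i \<omega>)) = m"
      unfolding m_def by (rule distributed_integral_AE_nonneg[OF Di _ fpos]) auto
    \<comment> \<open>The mean obeys the same bound as \<open>g\<close>, whence
      \<open>4 * L\<^sub>0\<close> for the centred variable.\<close>
    have mb: "\<bar>m\<bar> \<le> 2 * L\<^sub>0"
    proof -
      have "\<bar>m\<bar> \<le> expectation (\<lambda>\<omega>. \<bar>g (X i \<omega>)\<bar>)"
        unfolding Em[symmetric] by (rule integral_abs_bound)
      also have "\<dots> \<le> expectation (\<lambda>\<omega>. 2 * L\<^sub>0)"
        using gX intg by (intro integral_mono_AE) auto
      finally show ?thesis
        by (simp add: prob_space)
    qed
    have Zb: "AE \<omega> in M. \<bar>Z \<omega>\<bar> \<le> 4 * L\<^sub>0"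
      using gX by eventually_elim (use mb in \<open>simp add: Z_def\<close>)
    have EZ: "expectation Z = 0"
      unfolding Z_def using intg Em by (simp add: prob_space)
    have "expectation (\<lambda>\<omega>. (Z \<omega>)\<^sup>2) = expectation (\<lambda>\<omega>. (g (X i \<omega>))\<^sup>2) - m\<^sup>2"
      unfolding Z_def Em[symmetric] by (rule variance_eq[OF intg intg2])
    also have "\<dots> \<le> expectation (\<lambda>\<omega>. (g (X i \<omega>))\<^sup>2)"
      by simp
    also have "\<dots> = (\<integral>y. (g y)\<^sup>2 * f y \<partial>\<mu>)"
      by (rule distributed_integral_AE_nonneg[OF Di _ fpos]) auto
    \<comment> \<open>The bound on the density turns the second moment under \<open>f\<close> into a
      multiple of the squared norm with respect to \<open>\<mu>\<close>.\<close>
    also have "\<dots> \<le> (\<integral>y. L * (g y)\<^sup>2 \<partial>\<mu>)"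
    proof (rule integral_mono_AE')
      show "integrable \<mu> (\<lambda>y. L * (g y)\<^sup>2)"
        using g by (simp add: L2_fun_def)
      show "AE y in \<mu>. (g y)\<^sup>2 * f y \<le> L * (g y)\<^sup>2"
        using L by eventually_elim (simp add: mult.commute mult_right_mono)
      show "AE y in \<mu>. 0 \<le> L * (g y)\<^sup>2"
        using Lpos by simp
    qed
    finally have var: "expectation (\<lambda>\<omega>. (Z \<omega>)\<^sup>2) \<le> L * N"
      by (simp add: N_def L2_norm_sq)
    \<comment> \<open>This says \<open>\<beta> > 8 * L\<^sub>0 / 3\<close>, strict since
      \<open>L\<close> is positive.\<close>
    have tb: "2 / \<beta> * (4 * L\<^sub>0) < 3"
      using \<beta>pos Lpos \<beta> by (simp add: field_simps)
    have t0: "0 \<le> 2 / \<beta>"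
      using \<beta>pos by simp
    note B = Bernstein_mgf[OF Zm Zb EZ t0 tb]
    have split: "h (X i \<omega>) = exp (2 / \<beta> * Z \<omega>) * exp (- (1 / (2 * \<beta>) * N))" for \<omega>
      by (simp add: h_def Z_def exp_add[symmetric])
    have "expectation (\<lambda>\<omega>. exp (2 / \<beta> * Z \<omega>)) \<le>
        exp ((2 / \<beta>)\<^sup>2 * expectation (\<lambda>\<omega>. (Z \<omega>)\<^sup>2) / (2 * (1 - 2 / \<beta> * (4 * L\<^sub>0) / 3)))"
      by (rule B(2))
    also have "\<dots> \<le> exp ((2 / \<beta>)\<^sup>2 * (L * N) / (2 * (1 - 2 / \<beta> * (4 * L\<^sub>0) / 3)))"
      using tb by (simp only: exp_le_cancel_iff) (intro divide_right_mono mult_left_mono var; simp)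
    also have "(2 / \<beta>)\<^sup>2 * (L * N) / (2 * (1 - 2 / \<beta> * (4 * L\<^sub>0) / 3)) = 1 / (2 * \<beta>) * N"
    proof -
      \<comment> \<open>The \<open>8 * L\<^sub>0 / 3\<close> in \<open>\<beta>\<close> cancels
        Bernstein's correction; the remaining \<open>4 * L\<close> cancels the \<open>L\<close> of
        the variance bound.\<close>
      have *: "1 - 2 / \<beta> * (4 * L\<^sub>0) / 3 = 4 * L / \<beta>"
        using \<beta>pos by (simp add: divide_simps) (simp add: \<beta> algebra_simps)
      show ?thesis
        unfolding * using \<beta>pos Lpos by (simp add: field_simps power2_eq_square)
    qed
    finally have "expectation (\<lambda>\<omega>. exp (2 / \<beta> * Z \<omega>)) * exp (- (1 / (2 * \<beta>) * N)) \<le> 1"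
      by (simp add: exp_minus field_simps)
    then show ?thesis
      using B(1) by (simp add: split)
  qed
  have Y: "Y = (\<lambda>\<omega>. \<Prod>i\<in>{1..n}. h (X i \<omega>))"
    by (simp add: Y_def h_def exp_sum m_def N_def)
  have ind': "indep_vars (\<lambda>_. borel) (\<lambda>i \<omega>. h (X i \<omega>)) {1..n}"
    using hm by (intro indep_vars_compose2[OF ind]) auto
  show "integrable M Y"
    unfolding Y using factor by (intro indep_vars_integrable[OF _ ind']) auto
  have "expectation Y = (\<Prod>i\<in>{1..n}. expectation (\<lambda>\<omega>. h (X i \<omega>)))"
    unfolding Y using factor by (intro indep_vars_lebesgue_integral[OF _ ind']) auto
  also have "\<dots> \<le> 1"
    using factor by (intro prod_le_1) (auto simp: h_def intro!: integral_nonneg_AE)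
  finally show "expectation Y \<le> 1" .
qed

section \<open>The oracle inequality with high probability\<close>

theorem theorem3p1:
  fixes P :: "'w measure" and \<mu> :: "'a measure"
    and f :: "'a \<Rightarrow> real" and fs :: "'m::finite \<Rightarrow> 'a \<Rightarrow> real"
    and w :: "'m \<Rightarrow> real"
    and X :: "nat \<Rightarrow> 'w \<Rightarrow> 'a" and n :: nat
    and L L\<^sub>0 \<beta> x :: real
    and \<theta>hat :: "'w \<Rightarrow> real ^ 'm"
  assumes "prob_space P"
    and "n \<ge> 1"
    and "probability_density \<mu> f"
    and "iid_with_density P \<mu> f n X"
    and "\<And>j. L2_fun \<mu> (fs j)"
    and "\<And>j. Linf_norm \<mu> (fs j) \<le> ereal L\<^sub>0"
    and "Linf_norm \<mu> f \<le> ereal L"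
    and "\<And>j. w j > 0"
    and "(\<Sum>j\<in>UNIV. w j) = 1"
    and "\<beta> = 4 * L + 8 * L\<^sub>0 / 3"
    and "\<And>\<omega>. \<omega> \<in> space P \<Longrightarrow>
           is_arg_min (Hn \<mu> fs w \<beta> n (\<lambda>i. X i \<omega>)) (\<lambda>\<theta>. \<theta> \<in> prob_simplex) (\<theta>hat \<omega>)"
    and "x > 0"
  shows "measure P {\<omega> \<in> space P.
           risk \<mu> f (mixture fs (\<theta>hat \<omega>))
             \<le> (MIN j. risk \<mu> f (fs j) + \<beta> / real n * ln (1 / w j)) + \<beta> * x / real n}
         > 1 - exp (- x)"
proof -
  interpret prob_space P
    by fact
  note dens = assms(3) and iid = assms(4) and fs = assms(5) and w = assms(8)
    and \<beta> = assms(10) and min = assms(11)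
  have n: "0 < real n"
    using assms(2) by simp
  have fL: "AE y in \<mu>. \<bar>f y\<bar> \<le> L"
    using Linf_norm_AE[OF assms(7)] .
  have fsL: "AE y in \<mu>. \<bar>fs j y\<bar> \<le> L\<^sub>0" for j
    using Linf_norm_AE[OF assms(6)] .
  have L: "0 < L"
    by (rule bounded_density_pos[OF dens fL])
  have f2: "L2_fun \<mu> f"
    by (rule bounded_density_L2[OF dens fL])
  \<comment> \<open>A negative \<open>L\<^sub>0\<close> would make \<open>\<mu>\<close> the null
    measure, which carries no density of mass 1. Here \<open>undefined\<close> is just some
    index.\<close>
  have L0: "0 \<le> L\<^sub>0"
  proof (rule ccontr)
    assume "\<not> 0 \<le> L\<^sub>0"
    then have "AE y in \<mu>. f y = 0"
      using fsL[of undefined] by (auto elim!: eventually_mono)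
    then have "(\<integral>y. f y \<partial>\<mu>) = 0"
      by (rule integral_eq_zero_AE)
    then show False
      using probability_density_integral(2)[OF dens] by simp
  qed
  have \<beta>pos: "0 < \<beta>"
    using L L0 \<beta> by simp
  have Xm [measurable]: "X i \<in> measurable P \<mu>" if "i \<in> {1..n}" for i
    using iid that by (auto simp: iid_with_density_def intro: distributed_measurable)
  have fsm [measurable]: "fs j \<in> borel_measurable \<mu>" for j
    using fs by (simp add: L2_fun_def)

  define R where "R \<omega> = risk \<mu> f (mixture fs (\<theta>hat \<omega>))" for \<omega>
  define K where "K = (L2_norm \<mu> (\<lambda>y. 2 * ((\<Sum>j\<in>UNIV. \<bar>fs j y\<bar>) + \<bar>f y\<bar>)))\<^sup>2"
  define v :: "'w \<Rightarrow> real ^ 'm" where "v \<omega> = (\<chi> j. \<Sum>i=1..n. fs j (X i \<omega>))" for \<omega>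
  have \<theta>S: "\<theta>hat \<omega> \<in> prob_simplex" if "\<omega> \<in> space P" for \<omega>
    using min[OF that] by (simp add: is_arg_min_linorder)
  \<comment> \<open>\<open>measure\<close> is 0 on sets that are not events, so the set in the
    conclusion must be shown measurable. The risk is a Hoelder function of the sums
    \<open>v\<close>, although \<open>\<theta>hat\<close> is an arbitrary selection of
    minimizers.\<close>
  have Rm [measurable]: "R \<in> borel_measurable P"
  proof (rule borel_measurable_of_sq_dist_le)
    have "(\<lambda>\<omega>. \<Sum>i=1..n. fs j (X i \<omega>)) \<in> borel_measurable P" for j
      by (intro borel_measurable_sum measurable_compose[OF Xm fsm])
    then show "v \<in> borel_measurable P"
      by (subst borel_measurable_euclidean_space) (auto simp: v_def Basis_vec_def inner_axis)
    fix \<omega> \<omega>' assume \<omega>: "\<omega> \<in> space P" "\<omega>' \<in> space P"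
    have "(R \<omega> - R \<omega>')\<^sup>2 \<le>
        K * (L2_norm \<mu> (\<lambda>y. mixture fs (\<theta>hat \<omega>) y - mixture fs (\<theta>hat \<omega>') y))\<^sup>2"
      unfolding R_def K_def by (rule risk_diff_sq_le[where fs = fs, OF fs f2 \<theta>S \<theta>S]) (use \<omega> in auto)
    also have "\<dots> \<le> K * (4 / n * dist (v \<omega>) (v \<omega>'))"
      unfolding v_def by (intro mult_left_mono minimizer_stability[where fs = fs, OF fs min min])
        (use \<omega> in \<open>auto simp: K_def\<close>)
    finally show "(R \<omega> - R \<omega>')\<^sup>2 \<le> (K * (4 / n)) * dist (v \<omega>) (v \<omega>')"
      by (simp add: mult.assoc)
  qed

  define r where "r j = risk \<mu> f (fs j) + \<beta> / real n * ln (1 / w j)" for j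
  \<comment> \<open>The best index \<open>k\<close> does not depend on the sample, so a union over
    \<open>j\<close> alone remains.\<close>
  obtain k where k: "(MIN j. r j) = r k"
    using Min_in[of "range r"] by fastforce
  define g where "g j y = fs j y - fs k y" for j y
  define A where "A j \<omega> = (\<Sum>i=1..n. 2 / \<beta> * (g j (X i \<omega>) - (\<integral>y. g j y * f y \<partial>\<mu>))
      - 1 / (2 * \<beta>) * (L2_norm \<mu> (g j))\<^sup>2)" for j \<omega>
  \<comment> \<open>Averaging the exponentials over the prior replaces a union bound: the price for
    index \<open>j\<close> is exactly \<open>ln (1 / w j)\<close>.\<close>
  define Y where "Y \<omega> = (\<Sum>j\<in>UNIV. w j * exp (A j \<omega>))" for \<omega>
  have g2: "L2_fun \<mu> (g j)" for j
    unfolding g_def by (intro L2_fun_diff fs)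
  have gb: "AE y in \<mu>. \<bar>g j y\<bar> \<le> 2 * L\<^sub>0" for j
    using fsL[of j] fsL[of k] by eventually_elim (simp add: g_def)
  have EA: "integrable P (\<lambda>\<omega>. exp (A j \<omega>))" "expectation (\<lambda>\<omega>. exp (A j \<omega>)) \<le> 1" for j
    unfolding A_def using exp_empirical_deviation_le_1[OF dens fL iid g2 gb L0 \<beta>] by auto
  have Yint: "integrable P Y"
    unfolding Y_def using EA(1) by (intro Bochner_Integration.integrable_sum integrable_mult_right)
  have "expectation Y = (\<Sum>j\<in>UNIV. w j * expectation (\<lambda>\<omega>. exp (A j \<omega>)))"
    unfolding Y_def using EA(1) by (subst Bochner_Integration.integral_sum) auto
  also have "\<dots> \<le> (\<Sum>j\<in>UNIV. w j * 1)"
    using EA(2) w by (intro sum_mono mult_left_mono) (auto intro: less_imp_le)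
  finally have EY: "expectation Y \<le> 1"
    using assms(9) by simp
  have Ypos: "0 < Y \<omega>" for \<omega>
    unfolding Y_def using w by (intro sum_pos) auto

  \<comment> \<open>If \<open>Y\<close> is at most \<open>exp x\<close>, so is each of its positive
    summands, and every vertex value in the deterministic bound is at most
    \<open>\<beta> * x / n\<close>.\<close>
  have bad: "exp x < Y \<omega>" if \<omega>: "\<omega> \<in> space P" and gt: "r k + \<beta> * x / n < R \<omega>" for \<omega>
  proof (rule ccontr)
    assume "\<not> exp x < Y \<omega>"
    then have Yx: "Y \<omega> \<le> exp x"
      by simp
    have Ax: "A j \<omega> - ln (1 / w j) \<le> x" for j
    proof -
      have "w j * exp (A j \<omega>) \<le> Y \<omega>"
        unfolding Y_def using w by (intro member_le_sum) (auto intro!: mult_nonneg_nonneg less_imp_le)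
      then have "exp (ln (w j) + A j \<omega>) \<le> exp x"
        using Yx w[of j] by (simp add: exp_add)
      then show ?thesis
        using w[of j] by (simp add: ln_div)
    qed
    let ?\<theta> = "\<theta>hat \<omega>"
    have eq: "2 / n * (\<Sum>i=1..n. (fs j (X i \<omega>) - fs k (X i \<omega>)) - (\<integral>y. (fs j y - fs k y) * f y \<partial>\<mu>))
       - 1 / 2 * (L2_norm \<mu> (\<lambda>y. fs j y - fs k y))\<^sup>2 - \<beta> / n * ln (1 / w j)
       = \<beta> / n * (A j \<omega> - ln (1 / w j))" for j
    proof -
      \<comment> \<open>The compensation in \<open>A\<close> is subtracted once per observation,
        hence the factor \<open>n\<close>.\<close>
      have "A j \<omega> = 2 / \<beta> * (\<Sum>i=1..n. g j (X i \<omega>) - (\<integral>y. g j y * f y \<partial>\<mu>))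
          - n / (2 * \<beta>) * (L2_norm \<mu> (g j))\<^sup>2"
        unfolding A_def by (simp only: sum_subtractf sum_distrib_left[symmetric]) simp
      moreover have "2 / n * S - 1 / 2 * N - \<beta> / n * l =
          \<beta> / n * ((2 / \<beta> * S - n / (2 * \<beta>) * N) - l)" for S N l
        using n \<beta>pos by (simp add: field_simps)
      ultimately show ?thesis
        unfolding g_def by simp
    qed
    have "R \<omega> - r k \<le> (\<Sum>j\<in>UNIV. ?\<theta> $ j * (\<beta> / n * (A j \<omega> - ln (1 / w j))))"
      using oracle_inequality_deterministic[where fs = fs, OF fs f2 assms(2) min[OF \<omega>], of k]
      unfolding R_def r_def eq by simp
    \<comment> \<open>A convex combination of vertex values is at most their common bound; this is
      uniform in the random weights.\<close>
    also have "\<dots> \<le> (\<Sum>j\<in>UNIV. ?\<theta> $ j * (\<beta> / n * x))"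
      using \<theta>S[OF \<omega>] \<beta>pos Ax by (intro sum_mono mult_left_mono) (auto simp: prob_simplex_def)
    also have "\<dots> = \<beta> * x / n"
      using \<theta>S[OF \<omega>] unfolding sum_distrib_right[symmetric] by (simp add: prob_simplex_def)
    finally show False
      using gt by simp
  qed

  define G where "G = {\<omega> \<in> space P. R \<omega> \<le> r k + \<beta> * x / n}"
  have G: "G \<in> events"
    unfolding G_def by measurable
  have Ym [measurable]: "Y \<in> borel_measurable P"
    using Yint by simp
  have "1 - prob G = prob (space P - G)"
    using prob_compl[OF G] by simp
  also have "\<dots> \<le> prob {\<omega> \<in> space P. exp x < Y \<omega>}"
    using bad by (intro finite_measure_mono) (auto simp: G_def not_le)
  also have "\<dots> < expectation Y / exp x"
    by (intro prob_gt_less Yint Ypos) auto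
  also have "\<dots> \<le> exp (- x)"
    using EY by (simp add: exp_minus field_simps)
  finally have "1 - exp (- x) < prob G"
    by simp
  then show ?thesis
    unfolding G_def R_def k[symmetric] unfolding r_def .
qed

end
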